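(* Let $G$ be obtained from a cyclically 5-edge-connected cubic graph by subdividing edges to form (degree 2) vertices $x_1,\dots,x_{2k}$. For every $1\le i\le 2k$ let $C_i$ be a cycle of $G$ of odd length with $x_i\in V(C_i)$. If $V(C_i)\cap V(C_j)=\emptyset$ whenever $i\ne j$, then $G$ has a perfect matching.
   Context: A graph is cyclically 5-edge-connected if there is no edge-cut with fewer than 5 edges for which both sides contain a cycle. Here $x_1,\dots,x_{2k}$ are all of the degree 2 vertices of $G$. *)

theory Defs
  imports "Graph_Theory.Subdivision"
begin

text \<open>
  An undirected multigraph (loops and parallel edges allowed) is a bidirected digraph
  \<open>(G, r)\<close>: an undirected edge is a pair \<open>{e, r e}\<close> of mutually reverse arcs, a loop
  being a pair of distinct arcs at one vertex. The degree of \<open>v\<close> is then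
  \<^term>\<open>out_degree G v\<close>, with loops counted twice.
\<close>

definition cubic :: "('a, 'b) pre_digraph \<Rightarrow> bool" where
  "cubic G \<longleftrightarrow> (\<forall>v \<in> verts G. out_degree G v = 3)"

text \<open>
  \<^const>\<open>pre_digraph.cycle\<close> only asks for a nonempty closed walk without repeated vertices, so
  it admits \<open>[e, r e]\<close>, which traverses one undirected edge back and forth. The second
  conjunct excludes this; a loop (length 1) and two parallel edges (length 2) remain cycles.
\<close>

definition ucycle :: "('a, 'b) pre_digraph \<Rightarrow> ('b \<Rightarrow> 'b) \<Rightarrow> 'b list \<Rightarrow> bool" where
  "ucycle G r p \<longleftrightarrow> pre_digraph.cycle G p \<and> (\<forall>e \<in> set p. r e \<notin> set p)"

definition cycle_verts :: "('a, 'b) pre_digraph \<Rightarrow> 'b list \<Rightarrow> 'a set" where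
  "cycle_verts G p = tail G ` set p"

text \<open>Only one of the two arcs of an undirected edge leaves \<open>X\<close>, so every edge counts once.\<close>

definition edge_cut :: "('a, 'b) pre_digraph \<Rightarrow> 'a set \<Rightarrow> 'b set" where
  "edge_cut G X = {e \<in> arcs G. tail G e \<in> X \<and> head G e \<notin> X}"

definition cyclically_edge_connected ::
    "nat \<Rightarrow> ('a, 'b) pre_digraph \<Rightarrow> ('b \<Rightarrow> 'b) \<Rightarrow> bool" where
  "cyclically_edge_connected n G r \<longleftrightarrow>
     \<not> (\<exists>X \<subseteq> verts G. card (edge_cut G X) < n \<and>
          (\<exists>p. ucycle (G \<restriction> X) r p) \<and> (\<exists>q. ucycle (G \<restriction> (verts G - X)) r q))"

text \<open>
  A set of undirected edges is a set of arcs closed under reversal. A loop cannot belong to a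
  perfect matching, since both of its arcs have the same tail.
\<close>

definition perfect_matching :: "('a, 'b) pre_digraph \<Rightarrow> ('b \<Rightarrow> 'b) \<Rightarrow> 'b set \<Rightarrow> bool" where
  "perfect_matching G r M \<longleftrightarrow>
     M \<subseteq> arcs G \<and> r ` M \<subseteq> M \<and> (\<forall>v \<in> verts G. \<exists>!e. e \<in> M \<and> tail G e = v)"

end

theory Submission
  imports Defs "HOL-Library.Disjoint_Sets"
begin

text \<open>
  If \<open>G\<close> has no perfect matching, then Tutte's theorem (in Gallai's form, where all components
  are odd) gives a set \<open>S\<close> such that \<open>G - S\<close> has at least \<open>|S| + 2\<close> components \<open>K\<close>. Counting the
  edges at \<open>S\<close> shows that the sum of \<open>d(K) - 3\<close> over the components is at most \<open>-6 - 2 e(S)\<close>,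
  where \<open>d(K)\<close> is the size of the boundary of \<open>K\<close> and \<open>e(S)\<close> the number of edges inside \<open>S\<close>.
  The cycles \<open>C\<^sub>i\<close> are disjoint, so no two vertices of degree 2 are adjacent, and cyclic
  connectivity shows that only components \<open>{x\<^sub>i}\<close> have \<open>d(K) = 2\<close>. For such an \<open>i\<close> the cycle
  \<open>C\<^sub>i\<close> is odd, so it cannot alternate between \<open>S\<close> and singleton components: it uses an edge
  inside \<open>S\<close> or visits a larger component. A larger component visited by \<open>t\<close> of these cycles has
  \<open>d(K) \<ge> t + 3\<close>, which makes the sum too large.
\<close>

section \<open>Maximum matchings\<close>

text \<open>Loops and parallel edges do not affect whether a perfect matching exists, so Tutte's
  theorem is proved for sets of vertex pairs and carried over through
  \<open>edge_ends\<close>.\<close>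

definition matching :: "'a set set \<Rightarrow> 'a set set \<Rightarrow> bool" where
  "matching E M \<longleftrightarrow> M \<subseteq> E \<and> disjoint M"

definition max_matching :: "'a set set \<Rightarrow> 'a set set \<Rightarrow> bool" where
  "max_matching E M \<longleftrightarrow> matching E M \<and> (\<forall>N. matching E N \<longrightarrow> card N \<le> card M)"

lemma matchingD: "matching E M \<Longrightarrow> e \<in> M \<Longrightarrow> f \<in> M \<Longrightarrow> x \<in> e \<Longrightarrow> x \<in> f \<Longrightarrow> e = f"
  unfolding matching_def disjoint_def by blast

lemma matching_subset: "matching E M \<Longrightarrow> N \<subseteq> M \<Longrightarrow> matching E N"
  unfolding matching_def disjoint_def by blast

lemma matching_insert:
  "matching E M \<Longrightarrow> e \<in> E \<Longrightarrow> e \<inter> \<Union>M = {} \<Longrightarrow> matching E (insert e M)"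
  unfolding matching_def disjoint_def by blast

lemma matching_finite: "finite E \<Longrightarrow> matching E M \<Longrightarrow> finite M"
  unfolding matching_def by (auto intro: finite_subset)

lemma max_matching_ex:
  assumes "finite E"
  shows "\<exists>M. max_matching E M"
proof -
  have "card M < Suc (card E)" if "matching E M" for M
    using that card_mono[OF assms] by (auto simp: matching_def less_Suc_eq_le)
  moreover have "matching E {}" by (simp add: matching_def disjoint_def)
  ultimately show ?thesis
    using ex_has_greatest_nat[of "matching E" "{}" card "Suc (card E)"]
    unfolding max_matching_def by blast
qed

lemma max_matching_card_eq: "max_matching E M \<Longrightarrow> max_matching E N \<Longrightarrow> card M = card N"
  unfolding max_matching_def by (simp add: le_antisym)

lemma card_Union_matching:
  assumes "matching E M" "\<forall>e\<in>E. card e = 2"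
  shows "card (\<Union>M) = 2 * card M"
proof -
  have M: "\<And>e. e \<in> M \<Longrightarrow> card e = 2" using assms unfolding matching_def by blast
  have "card (\<Union>M) = sum card M"
    using assms(1) M by (intro card_Union_disjoint) (auto simp: matching_def intro: card_ge_0_finite)
  then show ?thesis using M by simp
qed

lemma max_matching_no_edge_missed:
  assumes "finite E" "max_matching E M" "{u, v} \<in> E" "u \<notin> \<Union>M" "v \<notin> \<Union>M"
  shows False
proof -
  have M: "matching E M" using assms(2) by (simp add: max_matching_def)
  have "matching E (insert {u, v} M)" using M assms(3-5) by (intro matching_insert) auto
  then have "card (insert {u, v} M) \<le> card M" using assms(2) by (simp add: max_matching_def)
  moreover have "{u, v} \<notin> M" using assms(4) by auto
  ultimately show False using matching_finite[OF assms(1) M] by simp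
qed

text \<open>Among the maximum matchings that miss \<open>t\<close>, one sharing as many edges as possible with \<open>M\<close>
  could still trade an edge for one of \<open>M\<close>.\<close>

lemma max_matching_missing_trans:
  assumes fin: "finite E" and two: "\<forall>e\<in>E. card e = 2"
    and M: "max_matching E M" "u \<notin> \<Union>M" "v \<notin> \<Union>M" "u \<noteq> v"
    and N0: "max_matching E N0" "t \<notin> \<Union>N0"
  shows "\<exists>L. max_matching E L \<and> t \<notin> \<Union>L \<and> (u \<notin> \<Union>L \<or> v \<notin> \<Union>L)"
proof (rule ccontr)
  assume contra: "\<not> ?thesis"
  then have cov: "u \<in> \<Union>L" "v \<in> \<Union>L" if "max_matching E L" "t \<notin> \<Union>L" for L
    using that by blast+
  have matM: "matching E M" and finM: "finite M"
    using M(1) matching_finite[OF fin] by (auto simp: max_matching_def)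
  let ?P = "\<lambda>N. max_matching E N \<and> t \<notin> \<Union>N"
  have "card (M \<inter> N) < Suc (card M)" for N
    using card_mono[OF finM, of "M \<inter> N"] by auto
  then obtain N where N: "max_matching E N" "t \<notin> \<Union>N"
    and best: "\<And>N'. max_matching E N' \<Longrightarrow> t \<notin> \<Union>N' \<Longrightarrow> card (M \<inter> N') \<le> card (M \<inter> N)"
    using ex_has_greatest_nat[of ?P N0 "\<lambda>N. card (M \<inter> N)" "Suc (card M)"] N0 by blast
  have matN: "matching E N" and finN: "finite N"
    using N(1) matching_finite[OF fin] by (auto simp: max_matching_def)
  have finE_edges: "\<And>e. e \<in> E \<Longrightarrow> finite e" using two by (simp add: card_ge_0_finite)
  have finU: "finite (\<Union>M)" "finite (\<Union>N)"
    using finM finN finE_edges matM matN by (auto simp: matching_def)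
  \<comment> \<open>\<open>N\<close> covers \<open>u\<close> and \<open>v\<close>, which
    \<open>M\<close> misses. Both matchings cover equally many vertices, so \<open>M\<close> covers
    at least two that \<open>N\<close> misses, one of them other than \<open>t\<close>.\<close>
  have "card (\<Union>M) = card (\<Union>N)"
    using card_Union_matching[OF matM two] card_Union_matching[OF matN two]
      max_matching_card_eq[OF M(1) N(1)] by simp
  then have "card (\<Union>M - \<Union>N) = card (\<Union>N - \<Union>M)"
    using finU by (simp add: card_Diff_subset_Int Int_commute)
  moreover have "card {u, v} \<le> card (\<Union>N - \<Union>M)"
    using finU(2) cov[OF N] M by (intro card_mono) auto
  ultimately have "\<not> \<Union>M - \<Union>N \<subseteq> {t}"
    using M(4) card_mono[of "{t}" "\<Union>M - \<Union>N"] by auto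
  then obtain x e where x: "x \<noteq> t" "x \<notin> \<Union>N" "x \<in> e" "e \<in> M" by blast
  have eE: "e \<in> E" using x matM by (auto simp: matching_def)
  then obtain y where y: "e = {x, y}" "x \<noteq> y"
    using two x(3) by (auto simp: card_2_iff doubleton_eq_iff)
  obtain f where f: "f \<in> N" "y \<in> f"
    using max_matching_no_edge_missed[OF fin N(1), of x y] eE x y by auto
  \<comment> \<open>Trading \<open>f\<close> for \<open>e\<close> keeps the size and still misses
    \<open>t\<close>. As \<open>e\<close> belongs to \<open>M\<close> and \<open>f\<close> does not,
    the overlap with \<open>M\<close> grows.\<close>
  let ?N = "insert e (N - {f})"
  have "e \<inter> \<Union>(N - {f}) = {}" using x y f matchingD[OF matN] by blast
  then have "matching E ?N"
    using eE by (intro matching_insert matching_subset[OF matN]) auto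
  moreover have eN: "e \<notin> N" using x by auto
  then have "card ?N = card N"
    using card_Suc_Diff1[OF finN f(1)] finN by simp
  ultimately have max: "max_matching E ?N" using N(1) by (simp add: max_matching_def)
  have "y \<noteq> t" using f N by auto
  then have "t \<notin> \<Union>?N" using x y N by auto
  note best[OF max this]
  moreover have "f \<notin> M"
    using matchingD[OF matM x(4), of f y] f y x eN by auto
  then have "M \<inter> ?N = insert e (M \<inter> N)" using x by auto
  ultimately show False using eN finM by simp
qed

text \<open>Gallai's lemma: being equal or never missed by a common maximum matching is a relation
  that contains the edges and is transitive by the previous lemma.\<close>

lemma max_matching_connected_not_both_missed:
  assumes fin: "finite E" and two: "\<forall>e\<in>E. card e = 2"
    and miss: "\<forall>v\<in>\<Union>E. \<exists>M. max_matching E M \<and> v \<notin> \<Union>M"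
    and "(u, v) \<in> {(a, b). {a, b} \<in> E}\<^sup>*" "u \<noteq> v" "max_matching E M" "u \<notin> \<Union>M"
  shows "v \<in> \<Union>M"
  using assms(4-)
proof (induction arbitrary: M rule: rtrancl_induct)
  case (step b c)
  then have bc: "{b, c} \<in> E" by simp
  show ?case
  proof (rule ccontr)
    assume c: "c \<notin> \<Union>M"
    have "u \<noteq> b"
      using max_matching_no_edge_missed[OF fin step.prems(2) bc] c step.prems by blast
    \<comment> \<open>The matching \<open>L\<close> obtained next misses \<open>b\<close> together
      with \<open>u\<close> or \<open>c\<close>. The first contradicts the induction hypothesis, the
      second the edge \<open>{b, c}\<close>.\<close>
    obtain N where "max_matching E N" "b \<notin> \<Union>N" using miss bc by blast
    then obtain L where "max_matching E L" "b \<notin> \<Union>L" "u \<notin> \<Union>L \<or> c \<notin> \<Union>L"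
      using max_matching_missing_trans[OF fin two step.prems(2,3) c step.prems(1)] by blast
    then show False
      using step.IH[OF \<open>u \<noteq> b\<close>] max_matching_no_edge_missed[OF fin _ bc] by blast
  qed
qed simp

text \<open>A largest set \<open>S\<close> each of whose vertices lowers the matching number by one leaves a graph in
  which every vertex is missed by some maximum matching, so that Gallai's lemma applies.\<close>

lemma tutte_gallai:
  assumes finV: "finite V" and EV: "\<forall>e\<in>E. e \<subseteq> V \<and> card e = 2"
    and evenV: "even (card V)" and nopm: "\<nexists>M. matching E M \<and> \<Union>M = V"
  obtains S P where "S \<subseteq> V" "\<Union>P = V - S" "disjoint P" "card S + 2 \<le> card P"
    "\<And>K. K \<in> P \<Longrightarrow> odd (card K)"
    "\<And>e. e \<in> E \<Longrightarrow> e \<inter> S = {} \<Longrightarrow> \<exists>K\<in>P. e \<subseteq> K"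
    "\<And>K x. K \<in> P \<Longrightarrow> x \<in> K \<Longrightarrow> K \<noteq> {x} \<Longrightarrow> \<exists>y\<in>K. {x, y} \<in> E"
proof -
  have finE: "finite E" using EV finV by (auto intro: finite_subset[of E "Pow V"])
  define F where "F U = {e \<in> E. e \<inter> U = {}}" for U
  have finF: "finite (F U)" and twoF: "\<forall>e\<in>F U. card e = 2" for U
    using finE EV by (auto simp: F_def)
  obtain M0 where M0: "max_matching E M0" using max_matching_ex[OF finE] by blast
  define Q where "Q U \<longleftrightarrow> U \<subseteq> V \<and> (\<exists>M. max_matching (F U) M \<and> card M + card U = card M0)" for U
  have "F {} = E" by (auto simp: F_def)
  then have "Q {}" using M0 by (auto simp: Q_def)
  moreover have "\<forall>U. Q U \<longrightarrow> card U < Suc (card V)"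
    using card_mono[OF finV] by (auto simp: Q_def less_Suc_eq_le)
  ultimately obtain S where S: "Q S" and S_max: "\<And>U. Q U \<Longrightarrow> card U \<le> card S"
    using ex_has_greatest_nat[of Q "{}" card "Suc (card V)"] by blast
  obtain M where M: "max_matching (F S) M" "card M + card S = card M0" and SV: "S \<subseteq> V"
    using S by (auto simp: Q_def)
  have finS: "finite S" using SV finV finite_subset by blast
  \<comment> \<open>If all maximum matchings of \<open>F S\<close> covered \<open>v\<close>,
    deleting \<open>v\<close> too would lower the matching number by exactly one, and
    \<open>insert v S\<close> would contradict the choice of \<open>S\<close>.\<close>
  have miss: "\<exists>N. max_matching (F S) N \<and> v \<notin> \<Union>N" if v: "v \<in> V - S" for v
  proof (rule ccontr)
    assume no: "\<not> ?thesis"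
    have FS: "F (insert v S) \<subseteq> F S" by (auto simp: F_def)
    have matM: "matching (F S) M" using M by (simp add: max_matching_def)
    obtain e where e: "e \<in> M" "v \<in> e" using no M by blast
    let ?M = "M - {e}"
    have "matching (F (insert v S)) ?M"
    proof -
      have "f \<inter> insert v S = {}" if "f \<in> ?M" for f
        using that matM matchingD[OF matM e(1) _ e(2), of f] by (auto simp: matching_def F_def)
      then show ?thesis using matching_subset[OF matM, of ?M] by (auto simp: matching_def F_def)
    qed
    moreover have "card N \<le> card ?M" if N: "matching (F (insert v S)) N" for N
    proof -
      have N': "matching (F S) N" "v \<notin> \<Union>N" using N FS by (auto simp: matching_def F_def)
      then have "\<not> max_matching (F S) N" using no by blast
      then have "card N < card M"
        using N' M unfolding max_matching_def by (meson le_trans not_le)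
      then show ?thesis using e by (simp add: card_Diff_singleton)
    qed
    ultimately have "max_matching (F (insert v S)) ?M" by (simp add: max_matching_def)
    moreover have "card ?M + card (insert v S) = card M0"
    proof -
      have "finite M" using matM matching_finite[OF finF] by blast
      then show ?thesis using M(2) v finS by (simp add: card.remove[OF _ e(1)])
    qed
    ultimately have "Q (insert v S)" using SV v by (auto simp: Q_def)
    from S_max[OF this] show False using v finS by simp
  qed
  \<comment> \<open>Components are the classes of reachability. The closure is reflexive, so
    isolated vertices become singleton components.\<close>
  let ?R = "{(a, b). {a, b} \<in> F S}"
  define cl where "cl v = ?R\<^sup>* `` {v}" for v
  have "sym ?R" by (auto simp: sym_def insert_commute)
  then have symR: "sym (?R\<^sup>*)" by (rule sym_rtrancl)
  have cl_eq: "cl u = cl v" if "v \<in> cl u" for u v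
    using that symD[OF symR] unfolding cl_def by (auto intro: rtrancl_trans)
  have cl_self: "v \<in> cl v" for v by (simp add: cl_def)
  have UF: "\<Union>(F S) \<subseteq> V - S" using EV by (auto simp: F_def)
  have cl_sub: "cl v \<subseteq> V - S" if "v \<in> V - S" for v
  proof
    fix w assume "w \<in> cl v"
    then have "(v, w) \<in> ?R\<^sup>*" by (simp add: cl_def)
    then show "w \<in> V - S" using that UF by induction auto
  qed
  have both: "v \<in> \<Union>N"
    if "v \<in> cl u" "u \<noteq> v" "max_matching (F S) N" "u \<notin> \<Union>N" for u v N
  proof (rule max_matching_connected_not_both_missed[OF finF twoF])
    show "\<forall>v\<in>\<Union>(F S). \<exists>M. max_matching (F S) M \<and> v \<notin> \<Union>M" using miss UF by blast
    show "(u, v) \<in> ?R\<^sup>*" using that by (simp add: cl_def)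
  qed (use that in auto)
  define P where "P = cl ` (V - S)"
  show thesis
  proof (rule that[OF SV, of P])
    show "\<Union>P = V - S" using cl_sub cl_self unfolding P_def by blast
    show "disjoint P" unfolding P_def disjoint_def using cl_eq by blast
    have matM: "matching (F S) M" using M by (simp add: max_matching_def)
    have UM: "\<Union>M \<subseteq> V - S" using UF matM by (auto simp: matching_def)
    \<comment> \<open>By Gallai's lemma \<open>M\<close> misses at most one vertex per component.
      The count that follows shows that it misses at least \<open>card S + 2\<close> vertices
      outside \<open>S\<close>.\<close>
    have "inj_on cl (V - S - \<Union>M)"
      using both[OF _ _ M(1)] cl_self by (intro inj_onI) blast
    then have "card (V - S - \<Union>M) \<le> card P"
      using finV by (auto simp: P_def intro!: card_inj_on_le)
    moreover have "card (V - S - \<Union>M) + card S + 2 * card M = card V"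
    proof -
      have "card (V - S - \<Union>M) + card (\<Union>M) = card (V - S)"
        using UM finV by (metis card_Diff_subset card_mono finite_Diff finite_subset le_add_diff_inverse2)
      moreover have "card (V - S) + card S = card V"
        using SV finV by (metis card_Diff_subset card_mono finite_subset le_add_diff_inverse2)
      ultimately show ?thesis using card_Union_matching[OF matM twoF] by simp
    qed
    \<comment> \<open>As \<open>card V\<close> is even, a matching that is not perfect misses at
      least two vertices.\<close>
    moreover have "2 * card M0 + 2 \<le> card V"
    proof -
      have mat0: "matching E M0" using M0 by (simp add: max_matching_def)
      have *: "card (\<Union>M0) = 2 * card M0" using card_Union_matching[OF mat0] EV by blast
      have "\<Union>M0 \<subset> V" using nopm mat0 EV by (auto simp: matching_def)
      then have "2 * card M0 < card V" using psubset_card_mono[OF finV] * by metis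
      then show ?thesis using evenV by presburger
    qed
    ultimately show "card S + 2 \<le> card P" using M(2) by linarith
    show "odd (card K)" if K: "K \<in> P" for K
    proof -
      obtain v where v: "v \<in> V - S" "K = cl v" using K by (auto simp: P_def)
      obtain N where N: "max_matching (F S) N" "v \<notin> \<Union>N" using miss v by blast
      then have matN: "matching (F S) N" by (simp add: max_matching_def)
      \<comment> \<open>\<open>N\<close> misses \<open>v\<close> and so, by Gallai's lemma, no other
        vertex of \<open>K\<close>: its edges meeting \<open>K\<close> pair up
        \<open>K - {v}\<close>.\<close>
      let ?N = "{e \<in> N. e \<inter> K \<noteq> {}}"
      have "e \<subseteq> K" if eK: "e \<in> ?N" for e
      proof -
        have eF: "e \<in> F S" using eK matN by (auto simp: matching_def)
        then obtain a b where ab: "e = {a, b}" using twoF by (meson card_2_iff)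
        have "(a, b) \<in> ?R" using eF ab by simp
        then have "b \<in> cl a" by (auto simp: cl_def)
        then have "cl a = cl b" by (rule cl_eq)
        obtain z where z: "z \<in> e" "z \<in> cl v" using eK v(2) by blast
        have "cl v = cl z" using z(2) by (rule cl_eq)
        then have "K = cl a" using v(2) ab z(1) \<open>cl a = cl b\<close> by auto
        then show ?thesis using ab cl_self[of a] cl_self[of b] \<open>cl a = cl b\<close> by simp
      qed
      then have "\<Union>?N \<subseteq> K - {v}" using N(2) by auto
      moreover have "w \<in> \<Union>?N" if w: "w \<in> K - {v}" for w
      proof -
        have "w \<in> \<Union>N" using both[of w v N] w v(2) N by auto
        then show ?thesis using w by auto
      qed
      ultimately have "\<Union>?N = K - {v}" by (intro equalityI subsetI) (erule subsetD, assumption)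
      moreover have "matching (F S) ?N" by (rule matching_subset[OF matN]) auto
      ultimately have "card (K - {v}) = 2 * card ?N" using card_Union_matching[OF _ twoF] by metis
      moreover have "finite K" using v cl_sub finV by (meson finite_Diff finite_subset)
      ultimately have "card K = Suc (2 * card ?N)"
        using card.remove[of K v] cl_self v(2) by simp
      then show ?thesis by simp
    qed
    show "\<exists>K\<in>P. e \<subseteq> K" if "e \<in> E" "e \<inter> S = {}" for e
    proof -
      have eF: "e \<in> F S" using that by (simp add: F_def)
      then obtain a b where ab: "e = {a, b}" using twoF by (meson card_2_iff)
      then have "e \<subseteq> cl a" "a \<in> V - S" using eF UF by (auto simp: cl_def)
      then show ?thesis by (auto simp: P_def)
    qed
    show "\<exists>y\<in>K. {x, y} \<in> E" if K: "K \<in> P" "x \<in> K" "K \<noteq> {x}" for K x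
    proof -
      have Kx: "K = cl x" using K cl_eq by (auto simp: P_def)
      then obtain z where "(x, z) \<in> ?R\<^sup>*" "z \<noteq> x" using K by (auto simp: cl_def)
      then obtain y where "(x, y) \<in> ?R" by (auto elim: converse_rtranclE)
      then show ?thesis unfolding Kx cl_def F_def by auto
    qed
  qed
qed

section \<open>Sparse vertex sets\<close>

definition inner_arcs :: "('a, 'b) pre_digraph \<Rightarrow> 'a set \<Rightarrow> 'b set" where
  "inner_arcs G Y = {e \<in> arcs G. tail G e \<in> Y \<and> head G e \<in> Y}"

text \<open>Every undirected edge is a pair of arcs, so this says that \<open>Z\<close> induces a forest.\<close>

definition sparse :: "('a, 'b) pre_digraph \<Rightarrow> 'a set \<Rightarrow> bool" where
  "sparse G Z \<longleftrightarrow> (\<forall>Y\<subseteq>Z. Y \<noteq> {} \<longrightarrow> card (inner_arcs G Y) < 2 * card Y)"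

section \<open>Cycles in vertex sets that are not sparse\<close>

lemma (in pre_digraph) cas_induce_subgraph: "pre_digraph.cas (G \<restriction> Y) u p v = cas u p v"
  by (induction u p v rule: cas.induct) (simp_all add: pre_digraph.cas.simps)

lemma (in pre_digraph) awalk_verts_induce_subgraph:
  "pre_digraph.awalk_verts (G \<restriction> Y) u p = awalk_verts u p"
  by (induction p arbitrary: u) (simp_all add: pre_digraph.awalk_verts.simps)

context bidirected_digraph
begin

lemma apath_no_backtrack:
  assumes "apath u p v" "e \<in> set p"
  shows "arev e \<notin> set p"
  using assms
proof (induction p arbitrary: u e)
  case (Cons f q)
  then have f: "f \<in> arcs G" "tail G f \<notin> set (awalk_verts (head G f) q)"
    and q: "apath (head G f) q v" by (auto simp: apath_Cons_iff)
  have "arev f \<notin> set q"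
    using awalk_verts_arc2[OF awalkI_apath[OF q], of "arev f"] f by auto
  then show ?case using Cons.IH[OF q] Cons.prems(2) arev_neq[OF f(1)] by auto
qed simp

text \<open>Quantifying over \<open>f\<close> encodes that at least two arcs of \<open>Y\<close>
  enter each vertex. Extending a longest path backwards at its start leads to a vertex already on
  it, which closes a cycle.\<close>

lemma min_degree_imp_ucycle:
  assumes Y: "finite Y" "Y \<subseteq> verts G" "Y \<noteq> {}"
    and deg: "\<And>v f. v \<in> Y \<Longrightarrow> \<exists>e\<in>inner_arcs G Y. head G e = v \<and> e \<noteq> f"
  shows "\<exists>p. ucycle (G \<restriction> Y) arev p"
proof -
  define Q where "Q p \<longleftrightarrow> (\<exists>u v. apath u p v \<and> set (awalk_verts u p) \<subseteq> Y)" for p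
  have "length p < Suc (card Y)" if p: "Q p" for p
  proof -
    obtain u v where uv: "apath u p v" "set (awalk_verts u p) \<subseteq> Y" using p Q_def by blast
    have "distinct (awalk_verts u p)" using uv(1) by (simp add: apath_def)
    moreover have "card (set (awalk_verts u p)) \<le> card Y" using card_mono[OF Y(1) uv(2)] .
    ultimately show ?thesis by (simp add: distinct_card length_awalk_verts)
  qed
  moreover have "Q []" using Y by (auto simp: Q_def apath_Nil_iff)
  ultimately obtain p where p: "Q p" and longest: "\<And>q. Q q \<Longrightarrow> length q \<le> length p"
    using ex_has_greatest_nat[of Q "[]" length "Suc (card Y)"] by blast
  obtain u v where uv: "apath u p v" "set (awalk_verts u p) \<subseteq> Y" using p Q_def by blast
  have "u \<in> set (awalk_verts u p)" using uv(1) by (rule hd_in_awalk_verts)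
  then have "u \<in> Y" using uv(2) by blast
  \<comment> \<open>Avoiding the reverse of the first arc keeps the cycle from retracing an edge.
    For the empty path \<open>hd p\<close> is unspecified; this is harmless, since \<open>e\<close>
    then turns out to be a loop.\<close>
  then obtain e where e: "e \<in> inner_arcs G Y" "head G e = u" "e \<noteq> arev (hd p)"
    using deg by blast
  then have eG: "e \<in> arcs G" "tail G e \<in> Y" by (auto simp: inner_arcs_def)
  have "tail G e \<in> set (awalk_verts u p)"
  proof (rule ccontr)
    assume "tail G e \<notin> set (awalk_verts u p)"
    then have "apath (tail G e) (e # p) v" using uv e eG by (simp add: apath_Cons_iff)
    then have "Q (e # p)" using uv e eG unfolding Q_def by (intro exI[of _ "tail G e"] exI[of _ v]) simp
    then show False using longest by fastforce
  qed
  then obtain q r where qr: "p = q @ r" "awalk u q (tail G e)"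
    using awalk_decomp[OF awalkI_apath[OF uv(1)]] by blast
  have "apath u (q @ r) v" using uv(1) qr by simp
  then have q: "apath u q (tail G e)" using qr(2) by (simp add: apath_append_iff)
  have qY: "set (awalk_verts u q) \<subseteq> Y"
    using uv awalk_verts_append[of u q r v] qr(1) by (auto simp: apath_def)
  have "ucycle (G \<restriction> Y) arev (e # q)"
    unfolding ucycle_def
  proof
    have "set q \<subseteq> inner_arcs G Y"
      using qr(2) qY awalk_verts_arc1[of _ q u] awalk_verts_arc2[OF qr(2)]
      by (auto simp: inner_arcs_def)
    then have "pre_digraph.awalk (G \<restriction> Y) (tail G e) (e # q) (tail G e)"
      using e eG qr(2)
      by (auto simp: pre_digraph.awalk_def cas_induce_subgraph inner_arcs_def)
    moreover have "distinct (tl (pre_digraph.awalk_verts (G \<restriction> Y) (tail G e) (e # q)))"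
      using q e by (simp add: awalk_verts_induce_subgraph apath_def)
    ultimately show "pre_digraph.cycle (G \<restriction> Y) (e # q)"
      unfolding pre_digraph.cycle_def by blast
    have "arev e \<notin> set q"
    proof
      assume "arev e \<in> set q"
      then obtain h q' where h: "q = h # q'" by (cases q) auto
      then have "tail G h = u" "u \<notin> set (awalk_verts (head G h) q')"
        using q by (auto simp: apath_Cons_iff)
      moreover have "arev e \<noteq> h" using e(3) qr(1) h by auto
      then have "arev e \<in> set q'" using \<open>arev e \<in> set q\<close> h by simp
      then have "tail G (arev e) \<in> set (awalk_verts (head G h) q')" by (rule awalk_verts_arc1)
      ultimately show False using e eG by simp
    qed
    then show "\<forall>g\<in>set (e # q). arev g \<notin> set (e # q)"
      using apath_no_backtrack[OF q] arev_neq[OF eG(1)] by auto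
  qed
  then show ?thesis by blast
qed

text \<open>In a smallest nonempty \<open>Y\<close> with at least \<open>2 * card Y\<close> inner
  arcs, two arcs enter every vertex: removing a vertex with at most one would lose at most two arcs
  and leave a smaller such set.\<close>

lemma not_sparse_imp_ucycle:
  assumes Z: "finite Z" "Z \<subseteq> verts G" "finite (arcs G)" "\<not> sparse G Z"
  shows "\<exists>p. ucycle (G \<restriction> Z) arev p"
proof -
  define Q where "Q Y \<longleftrightarrow> Y \<subseteq> Z \<and> Y \<noteq> {} \<and> 2 * card Y \<le> card (inner_arcs G Y)" for Y
  have "\<exists>Y. Q Y" using Z(4) by (auto simp: Q_def sparse_def not_less)
  then obtain Y where Y: "Q Y" and least: "\<And>X. Q X \<Longrightarrow> card Y \<le> card X"
    using ex_has_least_nat[of Q _ card] by blast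
  have YZ: "Y \<subseteq> Z" "Y \<noteq> {}" "2 * card Y \<le> card (inner_arcs G Y)" using Y by (auto simp: Q_def)
  have finY: "finite Y" using YZ(1) Z(1) finite_subset by blast
  have "\<exists>p. ucycle (G \<restriction> Y) arev p"
  proof (rule min_degree_imp_ucycle[OF finY _ YZ(2)])
    show "Y \<subseteq> verts G" using YZ Z by blast
    show "\<exists>e\<in>inner_arcs G Y. head G e = v \<and> e \<noteq> f" if v: "v \<in> Y" for v f
    proof (rule ccontr)
      assume "\<not> ?thesis"
      then have f: "e = f" if "e \<in> inner_arcs G Y" "head G e = v" for e using that by blast
      have "e = arev f" if "e \<in> inner_arcs G Y" "tail G e = v" for e
        using f[of "arev e"] that by (auto simp: inner_arcs_def)
      then have sub: "inner_arcs G Y \<subseteq> inner_arcs G (Y - {v}) \<union> {f, arev f}"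
        using f by (auto simp: inner_arcs_def)
      have fin: "finite (inner_arcs G (Y - {v}))" using Z(3) by (simp add: inner_arcs_def)
      have "card (inner_arcs G Y) \<le> card (inner_arcs G (Y - {v})) + card {f, arev f}"
        using card_mono[OF _ sub] fin card_Un_le[of "inner_arcs G (Y - {v})" "{f, arev f}"] by simp
      moreover have "card {f, arev f} \<le> 2" by (simp add: card_insert_if)
      moreover have "card Y = Suc (card (Y - {v}))" using card.remove[OF finY v] .
      ultimately have ge: "2 * card (Y - {v}) \<le> card (inner_arcs G (Y - {v}))"
        using YZ(3) by linarith
      show False
      proof (cases "Y = {v}")
        case True
        then have "inner_arcs G Y \<subseteq> {f}" using f by (auto simp: inner_arcs_def)
        then have "card (inner_arcs G Y) \<le> 1" using card_mono[of "{f}"] by simp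
        then show False using YZ(3) True by simp
      next
        case False
        then have "Q (Y - {v})" using v YZ(1) ge by (auto simp: Q_def)
        then show False using least \<open>card Y = Suc (card (Y - {v}))\<close> by fastforce
      qed
    qed
  qed
  then obtain p where p: "ucycle (G \<restriction> Y) arev p" by blast
  have "ucycle (G \<restriction> Z) arev p"
    using p YZ(1)
    unfolding ucycle_def pre_digraph.cycle_def pre_digraph.awalk_def
    by (auto simp: cas_induce_subgraph awalk_verts_induce_subgraph)
  then show ?thesis by blast
qed

end

text \<open>Cyclic 5-edge-connectivity with arc counts in place of cycles: it passes through
  subdivisions easily and fits into degree sums.\<close>

definition cut_sparse :: "('a, 'b) pre_digraph \<Rightarrow> bool" where
  "cut_sparse G \<longleftrightarrow> (\<forall>Z\<subseteq>verts G. card (edge_cut G Z) < 5 \<longrightarrow> sparse G Z \<or> sparse G (verts G - Z))"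

lemma cyclically_edge_connected_imp_cut_sparse:
  assumes "fin_digraph G" "bidirected_digraph G r" "cyclically_edge_connected 5 G r"
  shows "cut_sparse G"
proof -
  interpret fin_digraph G by fact
  interpret bidirected_digraph G r by fact
  show ?thesis
    unfolding cut_sparse_def
  proof (intro allI impI)
    fix Z assume Z: "Z \<subseteq> verts G" "card (edge_cut G Z) < 5"
    then have fin: "finite Z" "finite (verts G - Z)" by (auto intro: finite_subset)
    show "sparse G Z \<or> sparse G (verts G - Z)"
      using assms(3) Z not_sparse_imp_ucycle[OF fin(1) Z(1)] not_sparse_imp_ucycle[OF fin(2)]
      unfolding cyclically_edge_connected_def by auto
  qed
qed

section \<open>Subdivisions\<close>

context subdiv_step
begin

lemma arcs_H_old: "e \<in> arcs H \<Longrightarrow> e \<in> arcs G \<or> e \<in> {uw, wu, vw, wv}"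
  using arcs_H by blast

text \<open>In this locale \<open>H\<close> arises from \<open>G\<close> by placing \<open>w\<close>
  on an edge, so the letters are swapped against the final theorem. At its tail, \<open>uw\<close>
  replaces \<open>uv\<close>, and \<open>vw\<close> replaces \<open>vu\<close>.\<close>

lemma out_degree_old:
  assumes x: "x \<in> verts G"
  shows "out_degree H x = out_degree G x"
proof -
  define f where "f e = (if e = uv then uw else if e = vu then vw else e)" for e
  have xw: "x \<noteq> w" using x not_in_verts_G by blast
  have "inj_on f (arcs G)"
    using subdiv_distinct_arcs not_in_arcs_G by (auto simp: inj_on_def f_def)
  moreover have "f ` out_arcs G x = out_arcs H x"
  proof
    have "f e \<in> arcs H \<and> tail H (f e) = x" if "e \<in> arcs G" "tail G e = x" for e
    proof (cases "e \<in> {uv, vu}")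
      case True
      then show ?thesis using that in_arcs_H by (auto simp: f_def)
    next
      case False
      then show ?thesis using that by (auto simp: f_def arcs_H tail_eq)
    qed
    then show "f ` out_arcs G x \<subseteq> out_arcs H x" by auto
    show "out_arcs H x \<subseteq> f ` out_arcs G x"
    proof
      fix e assume e: "e \<in> out_arcs H x"
      then have "e \<in> arcs H" "tail H e = x" by auto
      consider "e \<in> arcs G" | "e = uw" | "e = vw" | "e = wu" | "e = wv"
        using arcs_H_old[OF \<open>e \<in> arcs H\<close>] by blast
      then show "e \<in> f ` out_arcs G x"
      proof cases
        case 1
        then have "f e = e" using not_in_arcs_H \<open>e \<in> arcs H\<close> by (auto simp: f_def)
        then show ?thesis using 1 \<open>tail H e = x\<close> by (auto simp: tail_eq intro!: image_eqI[of e f e])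
      next
        case 2
        then have "f uv = e" "uv \<in> out_arcs G x"
          using \<open>tail H e = x\<close> in_arcs_G by (auto simp: f_def)
        then show ?thesis by blast
      next
        case 3
        then have "f vu = e" "vu \<in> out_arcs G x"
          using \<open>tail H e = x\<close> in_arcs_G subdiv_distinct_arcs by (auto simp: f_def)
        then show ?thesis by blast
      qed (use \<open>tail H e = x\<close> xw in auto)
    qed
  qed
  ultimately show ?thesis
    unfolding out_degree_def
    by (metis card_image inj_on_subset out_arcs_in_arcs subsetI)
qed

text \<open>Adding \<open>w\<close> raises the bound by two, so two more arcs are affordable. If
  \<open>u\<close> and \<open>v\<close> both lie in the set, four new arcs replace \<open>uv\<close>
  and \<open>vu\<close>; otherwise at most one half of the subdivided edge lies inside.\<close>

lemma sparse_subdivided: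
  assumes fin: "finite (arcs G)" "finite Z" and sp: "sparse G (Z - {w})"
  shows "sparse H Z"
  unfolding sparse_def
proof (intro allI impI)
  fix Y assume Y: "Y \<subseteq> Z" "Y \<noteq> {}"
  let ?Y = "Y - {w}"
  have finY: "finite Y" using Y fin finite_subset by blast
  have finI: "finite (inner_arcs G ?Y)" using fin by (simp add: inner_arcs_def)
  have old: "e \<in> inner_arcs G ?Y - {uv, vu}" if "e \<in> inner_arcs H Y" "e \<notin> {uw, wu, vw, wv}" for e
  proof -
    have "e \<in> arcs G" "e \<in> arcs H" using that arcs_H_old[of e] by (auto simp: inner_arcs_def)
    then show ?thesis
      using that not_in_verts_G G.tail_in_verts[of e] G.head_in_verts[of e] not_in_arcs_H
      by (auto simp: inner_arcs_def tail_eq head_eq)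
  qed
  have lt: "card (inner_arcs G ?Y) < 2 * card ?Y" if "?Y \<noteq> {}"
    using sp that Y(1) unfolding sparse_def by (meson Diff_mono order_refl)
  show "card (inner_arcs H Y) < 2 * card Y"
  proof (cases "w \<in> Y")
    case False
    then have "e \<notin> {uw, wu, vw, wv}" if "e \<in> inner_arcs H Y" for e
      using that by (auto simp: inner_arcs_def)
    then have "inner_arcs H Y \<subseteq> inner_arcs G ?Y" using old by blast
    then have "card (inner_arcs H Y) \<le> card (inner_arcs G ?Y)" by (rule card_mono[OF finI])
    moreover have "?Y = Y" using False by simp
    ultimately show ?thesis using lt Y(2) by simp
  next
    case w: True
    have cY: "card Y = Suc (card ?Y)" using card.remove[OF finY w] .
    show ?thesis
    proof (cases "?Y = {}")
      case True
      then have "Y = {w}" using w by blast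
      then have "tail H e = w \<and> head H e = w" if "e \<in> inner_arcs H Y" for e
        using that unfolding inner_arcs_def by blast
      moreover have "tail H e \<noteq> w \<or> head H e \<noteq> w" if "e \<in> {uw, wu, vw, wv}" for e
        using that by (elim insertE emptyE) (simp_all add: subdiv_distinct_verts0)
      ultimately have "inner_arcs H Y \<subseteq> inner_arcs G ?Y" using old by blast
      then have "inner_arcs H Y = {}" using True by (auto simp: inner_arcs_def)
      then show ?thesis using cY by simp
    next
      case False
      have "card (inner_arcs H Y) \<le> card (inner_arcs G ?Y) + 2"
      proof (cases "u \<in> Y \<and> v \<in> Y")
        case True
        let ?I = "inner_arcs G ?Y - {uv, vu}"
        have "{uv, vu} \<subseteq> inner_arcs G ?Y"
          using True in_arcs_G subdiv_distinct_verts0 by (auto simp: inner_arcs_def)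
        then have "card (inner_arcs G ?Y) = card ?I + card {uv, vu}"
          using finI by (metis card_Diff_subset card_mono finite_subset le_add_diff_inverse2)
        moreover have "inner_arcs H Y \<subseteq> ?I \<union> {uw, wu, vw, wv}" using old by blast
        then have "card (inner_arcs H Y) \<le> card (?I \<union> {uw, wu, vw, wv})"
          using finI by (intro card_mono) auto
        moreover have "card (?I \<union> {uw, wu, vw, wv}) \<le> card ?I + card {uw, wu, vw, wv}"
          by (rule card_Un_le)
        moreover have "card {uw, wu, vw, wv} = 4" "card {uv, vu} = 2"
          using subdiv_distinct_arcs by auto
        ultimately show ?thesis by linarith
      next
        case False
        have "\<exists>a b. inner_arcs H Y \<subseteq> inner_arcs G ?Y \<union> {a, b}"
        proof (cases "u \<in> Y")
          case True
          then have "v \<notin> Y" using False by blast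
          then have "e \<notin> {vw, wv}" if "e \<in> inner_arcs H Y" for e
            using that by (auto simp: inner_arcs_def)
          then have "inner_arcs H Y \<subseteq> inner_arcs G ?Y \<union> {uw, wu}" using old by blast
          then show ?thesis by blast
        next
          case False
          then have "e \<notin> {uw, wu}" if "e \<in> inner_arcs H Y" for e
            using that by (auto simp: inner_arcs_def)
          then have "inner_arcs H Y \<subseteq> inner_arcs G ?Y \<union> {vw, wv}" using old by blast
          then show ?thesis by blast
        qed
        then obtain a b where "inner_arcs H Y \<subseteq> inner_arcs G ?Y \<union> {a, b}" by blast
        then have "card (inner_arcs H Y) \<le> card (inner_arcs G ?Y \<union> {a, b})"
          using finI by (intro card_mono) auto
        also have "\<dots> \<le> card (inner_arcs G ?Y) + card {a, b}" by (rule card_Un_le)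
        also have "card {a, b} \<le> 2" by (simp add: card_insert_if)
        finally show ?thesis by simp
      qed
      then show ?thesis using lt[OF False] cY by linarith
    qed
  qed
qed

lemma card_edge_cut_subdivided:
  assumes fin: "finite (arcs H)"
  shows "card (edge_cut G (Z - {w})) \<le> card (edge_cut H Z)"
proof -
  \<comment> \<open>A crossing edge survives as whichever of its halves crosses, depending on the
    side of \<open>w\<close>.\<close>
  define f where "f e = (if e = uv then if w \<in> Z then wv else uw
    else if e = vu then if w \<in> Z then wu else vw else e)" for e
  have "inj_on f (arcs G)"
    using subdiv_distinct_arcs not_in_arcs_G by (auto simp: inj_on_def f_def)
  then have "inj_on f (edge_cut G (Z - {w}))"
    by (rule inj_on_subset) (auto simp: edge_cut_def)
  moreover have "f e \<in> edge_cut H Z" if e: "e \<in> edge_cut G (Z - {w})" for e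
  proof -
    have eG: "e \<in> arcs G" "tail G e \<in> Z" "head G e \<notin> Z \<or> head G e = w"
      using e by (auto simp: edge_cut_def)
    have "head G e \<noteq> w" using G.head_in_verts[OF eG(1)] not_in_verts_G by blast
    then have hd: "head G e \<notin> Z" using eG by blast
    show ?thesis
    proof (cases "e = uv \<or> e = vu")
      case True
      then show ?thesis
        using eG hd in_arcs_H subdiv_distinct_arcs by (auto simp: edge_cut_def f_def)
    next
      case False
      then show ?thesis using eG hd by (auto simp: edge_cut_def f_def arcs_H tail_eq head_eq)
    qed
  qed
  ultimately show ?thesis
    using fin by (intro card_inj_on_le[of f]) (auto simp: edge_cut_def)
qed

lemma cut_sparse_subdivided:
  assumes fin: "fin_digraph G" and G: "cut_sparse G"
  shows "cut_sparse H"
proof -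
  interpret fin_digraph G by fact
  have finH: "finite (arcs H)" "finite (verts H)" by (simp_all add: arcs_H verts_H)
  show ?thesis
    unfolding cut_sparse_def
  proof (intro allI impI)
    fix Z assume Z: "Z \<subseteq> verts H" "card (edge_cut H Z) < 5"
    have "card (edge_cut G (Z - {w})) < 5"
      using card_edge_cut_subdivided[OF finH(1), of Z] Z(2) by linarith
    moreover have "Z - {w} \<subseteq> verts G" using Z(1) by (auto simp: verts_H)
    ultimately have "sparse G (Z - {w}) \<or> sparse G (verts G - (Z - {w}))"
      using G unfolding cut_sparse_def by blast
    moreover have "verts G - (Z - {w}) = (verts H - Z) - {w}"
      using not_in_verts_G by (auto simp: verts_H)
    moreover have "finite Z" using Z finH finite_subset by blast
    ultimately show "sparse H Z \<or> sparse H (verts H - Z)"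
      using sparse_subdivided finH by auto
  qed
qed

end

lemma subdivision_cubic:
  assumes "subdivision (H, rH) (G, rG)" "fin_digraph H" "cubic H" "cut_sparse H"
  shows "fin_digraph G \<and> (\<forall>v\<in>verts G. out_degree G v \<in> {2, 3}) \<and> cut_sparse G"
  using assms
proof (induction rule: subdivision_induct)
  case base
  then show ?case by (simp add: cubic_def)
next
  case (divide I rI G rG u v w uv uw vw)
  interpret subdiv_step I rI G rG u v w uv uw vw using divide.hyps by unfold_locales
  have I: "fin_digraph I" "\<forall>v\<in>verts I. out_degree I v \<in> {2, 3}" "cut_sparse I"
    using divide by auto
  interpret fI: fin_digraph I by fact
  have "fin_digraph G" by (intro H.fin_digraphI) (simp_all add: arcs_H verts_H)
  moreover have "\<forall>v\<in>verts G. out_degree G v \<in> {2, 3}"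
    using I(2) out_degree_old out_degree_w by (simp add: verts_H)
  ultimately show ?case using cut_sparse_subdivided[OF I(1,3)] by blast
qed

section \<open>Closed walks and cuts\<close>

lemma even_card_involution:
  assumes "finite A" "\<And>a. a \<in> A \<Longrightarrow> f a \<in> A \<and> f a \<noteq> a \<and> f (f a) = a"
  shows "even (card A)"
  using assms
proof (induction "card A" arbitrary: A rule: less_induct)
  case less
  show ?case
  proof (cases "A = {}")
    case False
    then obtain a where a: "a \<in> A" by blast
    let ?B = "A - {a, f a}"
    have sub: "{a, f a} \<subseteq> A" and two: "card {a, f a} = 2"
      using less.prems(2)[OF a] a by auto
    have card: "card A = card ?B + 2"
      using less.prems(1) sub two by (metis card_Diff_subset card_mono finite_subset le_add_diff_inverse2)
    have "f b \<in> ?B \<and> f b \<noteq> b \<and> f (f b) = b" if "b \<in> ?B" for b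
      using that less.prems(2)[of b] less.prems(2)[OF a] by auto
    then have "even (card ?B)" using less.hyps[of ?B] less.prems(1) card by auto
    then show ?thesis using card by simp
  qed simp
qed

context pre_digraph
begin

lemma cas_heads: "cas u p v \<Longrightarrow> head G ` set p \<subseteq> insert v (tail G ` set p)"
  by (induction u p v rule: cas.induct) (auto elim: cas.elims)

lemma cas_tails: "cas u p v \<Longrightarrow> tail G ` set p \<subseteq> insert u (head G ` set p)"
  by (induction u p v rule: cas.induct) auto

lemma cas_closed_heads_eq_tails:
  assumes "cas u p u" "p \<noteq> []"
  shows "head G ` set p = tail G ` set p"
proof -
  have u: "u \<in> tail G ` set p" using assms by (cases p) auto
  have "v \<in> head G ` set q" if "cas w q v" "q \<noteq> []" for w v q
    using that by (induction w q v rule: cas.induct) (force elim: cas.elims)+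
  then have "u \<in> head G ` set p" using assms by blast
  with u show ?thesis
    using cas_heads[OF assms(1)] cas_tails[OF assms(1)] by (simp add: insert_absorb subset_antisym)
qed

lemma cas_stays:
  assumes "cas u p v" "u \<in> X" "\<And>e. e \<in> set p \<Longrightarrow> tail G e \<in> X \<Longrightarrow> head G e \<in> X"
  shows "v \<in> X \<and> tail G ` set p \<subseteq> X"
  using assms by (induction u p v rule: cas.induct) auto

lemma cas_closed_leaves:
  assumes p: "cas u p u" and X: "tail G ` set p \<inter> X \<noteq> {}" "\<not> tail G ` set p \<subseteq> X"
  shows "\<exists>e\<in>set p. tail G e \<in> X \<and> head G e \<notin> X"
proof (rule ccontr)
  assume "\<not> ?thesis"
  then have stay: "e \<in> set p \<Longrightarrow> tail G e \<in> X \<Longrightarrow> head G e \<in> X" for e by blast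
  obtain e where "e \<in> set p" "tail G e \<in> X" using X(1) by blast
  then obtain q s where qs: "p = q @ e # s" by (meson split_list)
  then have "cas (tail G e) (e # s) u" using p by simp
  then have "u \<in> X" using cas_stays[OF _ \<open>tail G e \<in> X\<close>] stay qs by (metis Un_iff set_append)
  then show False using cas_stays[OF p _ stay] X(2) by simp
qed

text \<open>Each arc changes sides, so the parity of the length tells whether the ends lie on the
  same side. A closed walk of odd length cannot alternate.\<close>

lemma cas_alternating:
  assumes "cas u p v" "\<And>e. e \<in> set p \<Longrightarrow> tail G e \<in> X \<longleftrightarrow> head G e \<notin> X"
  shows "even (length p) \<longleftrightarrow> (u \<in> X \<longleftrightarrow> v \<in> X)"
  using assms by (induction u p v rule: cas.induct) auto

lemma ucycleD:
  assumes "ucycle G r p"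
  obtains u where "cas u p u" "p \<noteq> []" "set p \<subseteq> arcs G" "\<And>e. e \<in> set p \<Longrightarrow> r e \<notin> set p"
  using assms unfolding ucycle_def cycle_def awalk_def by blast

end

section \<open>Degree sums and the passage to simple edge sets\<close>

lemma (in fin_digraph) card_edge_cut_plus_inner_arcs:
  assumes "finite X"
  shows "card (edge_cut G X) + card (inner_arcs G X) = (\<Sum>v\<in>X. out_degree G v)"
proof -
  have "(\<Sum>v\<in>X. out_degree G v) = card (\<Union>v\<in>X. out_arcs G v)"
    unfolding out_degree_def using assms by (intro card_UN_disjoint[symmetric]) auto
  also have "(\<Union>v\<in>X. out_arcs G v) = edge_cut G X \<union> inner_arcs G X"
    by (auto simp: edge_cut_def inner_arcs_def)
  also have "card \<dots> = card (edge_cut G X) + card (inner_arcs G X)"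
    by (intro card_Un_disjoint) (auto simp: edge_cut_def inner_arcs_def)
  finally show ?thesis by simp
qed

definition edge_ends :: "('a, 'b) pre_digraph \<Rightarrow> 'a set set" where
  "edge_ends G = {{tail G e, head G e} | e. e \<in> arcs G \<and> tail G e \<noteq> head G e}"

lemma (in bidirected_digraph) perfect_matching_if_matching:
  assumes M: "matching (edge_ends G) M" "\<Union>M = verts G"
  shows "\<exists>M. perfect_matching G arev M"
proof -
  have "\<forall>m\<in>M. \<exists>e. e \<in> arcs G \<and> tail G e \<noteq> head G e \<and> m = {tail G e, head G e}"
    using M(1) unfolding matching_def edge_ends_def by blast
  then obtain c where c: "\<And>m. m \<in> M \<Longrightarrow> c m \<in> arcs G \<and> tail G (c m) \<noteq> head G (c m)"
    and ends: "\<And>m. m \<in> M \<Longrightarrow> m = {tail G (c m), head G (c m)}"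
    by metis
  \<comment> \<open>Choosing one arc per pair selects one of several parallel edges; the reverse
    arcs close the set under reversal.\<close>
  let ?N = "\<Union>m\<in>M. {c m, arev (c m)}"
  have "perfect_matching G arev ?N"
    unfolding perfect_matching_def
  proof (intro conjI ballI)
    show "?N \<subseteq> arcs G" using c by auto
    show "arev ` ?N \<subseteq> ?N" by auto
    fix v assume "v \<in> verts G"
    then obtain m where m: "m \<in> M" "v \<in> m" using M(2) by blast
    show "\<exists>!e. e \<in> ?N \<and> tail G e = v"
    proof (rule ex_ex1I)
      have "v \<in> {tail G (c m), head G (c m)}" using ends[OF m(1)] m(2) by blast
      then have "tail G (c m) = v \<or> tail G (arev (c m)) = v" using c[OF m(1)] by auto
      then show "\<exists>e. e \<in> ?N \<and> tail G e = v" using m(1) by blast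
      have only: "e \<in> {c m, arev (c m)}" if e: "e \<in> ?N" "tail G e = v" for e
      proof -
        obtain m' where m': "m' \<in> M" "e \<in> {c m', arev (c m')}" using e(1) by blast
        then have "tail G e \<in> {tail G (c m'), head G (c m')}" using c[OF m'(1)] by auto
        then have "v \<in> m'" using ends[OF m'(1)] e(2) by blast
        then have "m' = m" using matchingD[OF M(1)] m m'(1) by blast
        then show ?thesis using m' by simp
      qed
      have "tail G (arev (c m)) \<noteq> tail G (c m)" using c[OF m(1)] by (metis tail_arev)
      then show "e = f" if "e \<in> ?N \<and> tail G e = v" "f \<in> ?N \<and> tail G f = v" for e f
        using only[of e] only[of f] that by auto
    qed
  qed
  then show ?thesis by blast
qed

lemma (in bidirected_digraph) even_card_inner_arcs:
  assumes "finite (arcs G)"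
  shows "even (card (inner_arcs G X))"
  using assms arev_neq by (intro even_card_involution[of _ arev]) (auto simp: inner_arcs_def)

section \<open>Disjoint odd cycles through the vertices of degree 2\<close>

text \<open>What the counting uses of the subdivided cubic graph. Membership in the image of
  \<open>x\<close> separates degree 2 from degree 3.\<close>

locale odd_cycle_cover = fin_digraph G + bidirected_digraph G arev
  for G :: "('a, 'b) pre_digraph" and arev +
  fixes I :: "'i set" and x :: "'i \<Rightarrow> 'a" and C :: "'i \<Rightarrow> 'b list"
  assumes deg: "v \<in> verts G \<Longrightarrow> out_degree G v \<in> {2, 3}"
    and cut_sparse: "cut_sparse G"
    and x_bij: "bij_betw x I {v \<in> verts G. out_degree G v = 2}"
    and even_I: "even (card I)"
    and C_cycle: "i \<in> I \<Longrightarrow> ucycle G arev (C i)"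
    and C_odd: "i \<in> I \<Longrightarrow> odd (length (C i))"
    and x_C: "i \<in> I \<Longrightarrow> x i \<in> cycle_verts G (C i)"
    and C_disj: "i \<in> I \<Longrightarrow> j \<in> I \<Longrightarrow> i \<noteq> j \<Longrightarrow> cycle_verts G (C i) \<inter> cycle_verts G (C j) = {}"
begin

lemma C_unique: "i \<in> I \<Longrightarrow> j \<in> I \<Longrightarrow> v \<in> cycle_verts G (C i) \<Longrightarrow> v \<in> cycle_verts G (C j) \<Longrightarrow> i = j"
  using C_disj by blast

lemma x_image: "x ` I = {v \<in> verts G. out_degree G v = 2}"
  using x_bij by (rule bij_betw_imp_surj_on)

lemma x_inj: "inj_on x I"
  using x_bij by (rule bij_betw_imp_inj_on)

lemma finite_I: "finite I"
  using bij_betw_finite[OF x_bij] by simp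

lemma sum_out_degree:
  assumes "X \<subseteq> verts G"
  shows "(\<Sum>v\<in>X. out_degree G v) = 3 * card (X - x ` I) + 2 * card (X \<inter> x ` I)"
proof -
  have fin: "finite X" using assms finite_verts finite_subset by blast
  have "(\<Sum>v\<in>X. out_degree G v) = (\<Sum>v\<in>X - x ` I. out_degree G v) + (\<Sum>v\<in>X \<inter> x ` I. out_degree G v)"
    using fin by (subst sum.union_disjoint[symmetric]) (auto intro: sum.cong)
  also have "(\<Sum>v\<in>X - x ` I. out_degree G v) = (\<Sum>v\<in>X - x ` I. 3)"
    using deg assms by (intro sum.cong) (auto simp: x_image)
  also have "(\<Sum>v\<in>X \<inter> x ` I. out_degree G v) = (\<Sum>v\<in>X \<inter> x ` I. 2)"
    using deg assms by (intro sum.cong) (auto simp: x_image)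
  finally show ?thesis by simp
qed

lemma card_edge_cut:
  assumes "X \<subseteq> verts G"
  shows "card (edge_cut G X) + card (inner_arcs G X) = 3 * card (X - x ` I) + 2 * card (X \<inter> x ` I)"
  using assms card_edge_cut_plus_inner_arcs[of X] sum_out_degree[of X] finite_subset[OF _ finite_verts]
  by simp

text \<open>By parity a sparse set has at most \<open>2 * card X - 2\<close> inner arcs. Subtracting
  this from the degree sum leaves two, plus one for each vertex of degree 3.\<close>

lemma sparse_card_edge_cut:
  assumes "X \<subseteq> verts G" "X \<noteq> {}" "sparse G X"
  shows "card (X - x ` I) + 2 \<le> card (edge_cut G X)"
proof -
  have "card (inner_arcs G X) < 2 * card X" using assms by (simp add: sparse_def)
  then have "card (inner_arcs G X) + 2 \<le> 2 * card X"
    using even_card_inner_arcs[OF finite_arcs, of X] by presburger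
  moreover have "finite X" using assms(1) finite_subset[OF _ finite_verts] by blast
  then have "card X = card (X - x ` I) + card (X \<inter> x ` I)"
    by (metis Int_commute add.commute card_Diff_subset_Int card_mono finite_Int inf_le2 le_add_diff_inverse)
  ultimately show ?thesis using card_edge_cut[OF assms(1)] by linarith
qed

text \<open>The number of vertices of degree 3 is even because the number of arcs is; that of degree
  2 is even by \<open>even_I\<close>.\<close>

lemma even_card_verts: "even (card (verts G))"
proof -
  have "edge_cut G (verts G) = {}" "inner_arcs G (verts G) = arcs G"
    by (auto simp: edge_cut_def inner_arcs_def)
  then have "card (arcs G) = 3 * card (verts G - x ` I) + 2 * card (verts G \<inter> x ` I)"
    using card_edge_cut[of "verts G"] by simp
  moreover have "even (card (arcs G))"
    using even_card_inner_arcs[OF finite_arcs, of "verts G"] \<open>inner_arcs G (verts G) = arcs G\<close> by simp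
  ultimately have "even (card (verts G - x ` I))" by presburger
  moreover have "card (x ` I) = card I" using x_inj by (rule card_image)
  moreover have "card (verts G) = card (verts G - x ` I) + card (x ` I)"
    using x_image finite_I
    by (metis (no_types, lifting) card_Diff_subset card_mono finite_imageI finite_verts le_add_diff_inverse2 mem_Collect_eq subsetI)
  ultimately show ?thesis using even_I by simp
qed

text \<open>The arc by which \<open>C i\<close> leaves \<open>x i\<close> and the reverse of the arc
  by which it enters are distinct, and degree 2 leaves no room for a third arc.\<close>

lemma x_neighbour:
  assumes "i \<in> I" "e \<in> arcs G" "tail G e = x i"
  shows "head G e \<in> cycle_verts G (C i)"
proof -
  obtain u where C: "cas u (C i) u" "C i \<noteq> []" "set (C i) \<subseteq> arcs G"
    and norev: "\<And>e. e \<in> set (C i) \<Longrightarrow> arev e \<notin> set (C i)"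
    using C_cycle[OF assms(1)] ucycleD by blast
  note ht = cas_closed_heads_eq_tails[OF C(1,2)]
  obtain f where f: "f \<in> set (C i)" "tail G f = x i"
    using x_C[OF assms(1)] by (auto simp: cycle_verts_def)
  have "x i \<in> head G ` set (C i)" using x_C[OF assms(1)] ht by (simp add: cycle_verts_def)
  then obtain g where g: "g \<in> set (C i)" "head G g = x i" by auto
  have "{f, arev g} \<subseteq> out_arcs G (x i)" using f g C(3) by auto
  moreover have "card (out_arcs G (x i)) = 2"
    using assms(1) x_image unfolding out_degree_def by blast
  moreover have "f \<noteq> arev g" using norev[OF g(1)] f(1) by blast
  ultimately have "out_arcs G (x i) = {f, arev g}"
    using card_subset_eq[of "out_arcs G (x i)" "{f, arev g}"] by auto
  moreover have "e \<in> out_arcs G (x i)" using assms(2,3) by simp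
  ultimately have "e = f \<or> e = arev g" by blast
  moreover have "head G f \<in> cycle_verts G (C i)" using f(1) ht by (auto simp: cycle_verts_def)
  moreover have "head G (arev g) = tail G g" using g(1) C(3) by (intro head_arev) blast
  then have "head G (arev g) \<in> cycle_verts G (C i)" using g(1) by (simp add: cycle_verts_def)
  ultimately show ?thesis by blast
qed

text \<open>The neighbour lies on \<open>C i\<close>, where disjointness allows no
  \<open>x j\<close> but \<open>x i\<close>. The last assumption sets loops aside.\<close>

lemma x_neighbour_not_x:
  assumes "i \<in> I" "e \<in> arcs G" "tail G e = x i" "head G e \<noteq> x i"
  shows "head G e \<notin> x ` I"
proof
  assume "head G e \<in> x ` I"
  then obtain j where j: "j \<in> I" "head G e = x j" by blast
  have "x j \<in> cycle_verts G (C i)" using x_neighbour[OF assms(1-3)] j(2) by simp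
  then have "i = j" using C_unique[OF assms(1) j(1)] x_C[OF j(1)] by blast
  then show False using assms(4) j(2) by simp
qed

end

section \<open>Counting at a violation of Tutte's condition\<close>

locale tutte_violation = odd_cycle_cover +
  fixes S P
  assumes S: "S \<subseteq> verts G" and P: "\<Union>P = verts G - S" "disjoint P" "card S + 2 \<le> card P"
    and P_odd: "K \<in> P \<Longrightarrow> odd (card K)"
    and P_sep: "e \<in> arcs G \<Longrightarrow> tail G e \<notin> S \<Longrightarrow> head G e \<notin> S \<Longrightarrow> \<exists>K\<in>P. tail G e \<in> K \<and> head G e \<in> K"
    and P_conn: "K \<in> P \<Longrightarrow> v \<in> K \<Longrightarrow> K \<noteq> {v} \<Longrightarrow> \<exists>e\<in>arcs G. tail G e = v \<and> head G e \<in> K - {v}"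
begin

lemma P_sub: "K \<in> P \<Longrightarrow> K \<subseteq> verts G - S"
  using P(1) by blast

lemma P_eq: "K \<in> P \<Longrightarrow> L \<in> P \<Longrightarrow> v \<in> K \<Longrightarrow> v \<in> L \<Longrightarrow> K = L"
  using disjointD[OF P(2), of K L] by blast

lemma finite_P: "finite P"
  using P(1) finite_verts by (metis finite_Diff finite_UnionD)

lemma finite_K: "K \<in> P \<Longrightarrow> finite K"
  using P_sub finite_verts finite_subset by blast

lemma edge_cut_head: "K \<in> P \<Longrightarrow> e \<in> edge_cut G K \<Longrightarrow> head G e \<in> S"
proof (rule ccontr)
  assume K: "K \<in> P" "e \<in> edge_cut G K" and "head G e \<notin> S"
  then have e: "e \<in> arcs G" "tail G e \<in> K" "head G e \<notin> K" by (auto simp: edge_cut_def)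
  then have "tail G e \<notin> S" using P_sub[OF K(1)] by blast
  then obtain L where "L \<in> P" "tail G e \<in> L" "head G e \<in> L"
    using P_sep[OF e(1)] \<open>head G e \<notin> S\<close> by blast
  then show False using P_eq[OF K(1)] e by blast
qed

text \<open>Arcs leaving a component end in \<open>S\<close>, so their reverses are distinct arcs
  leaving \<open>S\<close>, whose degree sum is at most \<open>3 * card S\<close>.\<close>

lemma sum_edge_cut: "(\<Sum>K\<in>P. card (edge_cut G K)) + card (inner_arcs G S) \<le> 3 * card S"
proof -
  have "(\<Sum>K\<in>P. card (edge_cut G K)) = card (\<Union>K\<in>P. edge_cut G K)"
    using finite_P P_eq by (intro card_UN_disjoint[symmetric]) (auto simp: edge_cut_def)
  also have "\<dots> \<le> card (edge_cut G S)"
  proof (rule card_inj_on_le)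
    show "inj_on arev (\<Union>K\<in>P. edge_cut G K)" by (rule inj_on_arev)
    have "arev e \<in> edge_cut G S" if "K \<in> P" "e \<in> edge_cut G K" for K e
      using edge_cut_head[OF that] P_sub[OF that(1)] that(2) by (auto simp: edge_cut_def)
    then show "arev ` (\<Union>K\<in>P. edge_cut G K) \<subseteq> edge_cut G S" by blast
  qed (simp add: edge_cut_def)
  finally have "(\<Sum>K\<in>P. card (edge_cut G K)) \<le> card (edge_cut G S)" .
  moreover have "card (S - x ` I) + card (S \<inter> x ` I) = card S"
    using finite_subset[OF S finite_verts]
    by (metis Int_commute add.commute card_Diff_subset_Int card_mono finite_Int inf_le2 le_add_diff_inverse)
  ultimately show ?thesis using card_edge_cut[OF S] by linarith
qed

definition A where "A = {i \<in> I. {x i} \<in> P}"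

text \<open>By \<open>cut_sparse\<close>, a component that is not good has a sparse complement; this
  case is refuted separately.\<close>

definition good where "good K \<longleftrightarrow> 5 \<le> card (edge_cut G K) \<or> sparse G K"

text \<open>For good \<open>K\<close>, each such cycle raises the lower bound on the boundary by
  one, which makes up for the small boundary of its own component \<open>{x i}\<close>.\<close>

definition visits where
  "visits K = {i \<in> A. \<not> is_singleton K \<and> cycle_verts G (C i) \<inter> K \<noteq> {}}"

lemma A_I: "i \<in> A \<Longrightarrow> i \<in> I" by (simp add: A_def)

lemma finite_A: "finite A" using finite_I by (simp add: A_def)

lemma visits_A: "i \<in> visits K \<Longrightarrow> i \<in> A" by (simp add: visits_def)

lemma finite_visits: "finite (visits K)" using finite_A by (simp add: visits_def)

lemma A_not_in:
  assumes "K \<in> P" "i \<in> A" "\<not> is_singleton K"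
  shows "x i \<notin> K"
  using assms P_eq[of K "{x i}" "x i"] by (auto simp: A_def is_singleton_def)

text \<open>A visiting cycle contains \<open>x i\<close> outside \<open>K\<close>, so it leaves and
  enters \<open>K\<close>. The leaving arc and the reverse of the entering arc are two boundary
  arcs, and disjoint cycles give different ones.\<close>

lemma card_visits:
  assumes K: "K \<in> P"
  shows "2 * card (visits K) \<le> card (edge_cut G K)"
proof -
  define B where "B i = {e \<in> edge_cut G K. tail G e \<in> cycle_verts G (C i)}" for i
  have "2 \<le> card (B i)" if i: "i \<in> visits K" for i
  proof -
    have iI: "i \<in> I" using i A_I visits_A by blast
    obtain u where C: "cas u (C i) u" "C i \<noteq> []" "set (C i) \<subseteq> arcs G"
      and norev: "\<And>e. e \<in> set (C i) \<Longrightarrow> arev e \<notin> set (C i)"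
      using C_cycle[OF iI] ucycleD by blast
    have meet: "tail G ` set (C i) \<inter> K \<noteq> {}" "x i \<in> tail G ` set (C i)" "x i \<notin> K"
      using i x_C[OF iI] A_not_in[OF K] by (auto simp: visits_def cycle_verts_def)
    then obtain e where e: "e \<in> set (C i)" "tail G e \<in> K" "head G e \<notin> K"
      using cas_closed_leaves[OF C(1), of K] by blast
    obtain f where f: "f \<in> set (C i)" "tail G f \<notin> K" "head G f \<in> K"
      using cas_closed_leaves[OF C(1), of "- K"] meet by blast
    have "head G f \<in> tail G ` set (C i)"
      using f(1) cas_closed_heads_eq_tails[OF C(1,2)] by blast
    then have "{e, arev f} \<subseteq> B i"
      using e f C(3) by (auto simp: B_def edge_cut_def cycle_verts_def)
    moreover have "e \<noteq> arev f" using norev[OF f(1)] e(1) by blast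
    moreover have "finite (B i)" by (simp add: B_def edge_cut_def)
    ultimately show ?thesis using card_mono[of "B i" "{e, arev f}"] by simp
  qed
  then have "2 * card (visits K) \<le> (\<Sum>i\<in>visits K. card (B i))"
    using sum_mono[of "visits K" "\<lambda>_. 2" "\<lambda>i. card (B i)"] by simp
  also have "\<dots> = card (\<Union>i\<in>visits K. B i)"
  proof (rule card_UN_disjoint[symmetric])
    show "\<forall>i\<in>visits K. \<forall>j\<in>visits K. i \<noteq> j \<longrightarrow> B i \<inter> B j = {}"
      using C_disj A_I visits_A unfolding B_def by blast
  qed (auto simp: finite_visits B_def edge_cut_def)
  also have "\<dots> \<le> card (edge_cut G K)"
    by (intro card_mono) (auto simp: B_def edge_cut_def)
  finally show ?thesis .
qed

text \<open>The neighbours of \<open>x j\<close> lie on \<open>C j\<close>, so the cycles counted by \<open>visits K\<close> use up distinct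
  vertices of degree 3 other than a neighbour of \<open>x j\<close> in \<open>K\<close>.\<close>

lemma card_visits_degree_3:
  assumes K: "K \<in> P" "x j \<in> K" "j \<in> I" "\<not> is_singleton K"
  shows "card (visits K) < card (K - x ` I)"
proof -
  have "K \<noteq> {x j}" using K(4) by (auto simp: is_singleton_def)
  then obtain e where e: "e \<in> arcs G" "tail G e = x j" "head G e \<in> K" "head G e \<noteq> x j"
    using P_conn[OF K(1,2)] by blast
  have y: "head G e \<in> K - x ` I" "head G e \<in> cycle_verts G (C j)"
    using e x_neighbour_not_x[OF K(3)] x_neighbour[OF K(3)] by auto
  have "\<exists>p. p \<in> cycle_verts G (C i) \<and> p \<in> K - x ` I - {head G e}" if i: "i \<in> visits K" for i
  proof -
    have iA: "i \<in> A" and iI: "i \<in> I" using i visits_A A_I by blast+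
    have xi: "x i \<notin> K" using A_not_in[OF K(1) iA K(4)] .
    obtain p where p: "p \<in> cycle_verts G (C i)" "p \<in> K" using i by (auto simp: visits_def)
    have "p \<notin> x ` I" using p xi C_unique[OF iI] x_C by blast
    moreover have "p \<noteq> head G e" using C_unique[OF iI K(3) p(1)] y(2) K(2) xi by blast
    ultimately show ?thesis using p by blast
  qed
  then obtain p where p: "\<And>i. i \<in> visits K \<Longrightarrow> p i \<in> cycle_verts G (C i) \<and> p i \<in> K - x ` I - {head G e}"
    by metis
  have "inj_on p (visits K)"
    using p C_unique A_I visits_A by (intro inj_onI) metis
  then have "card (visits K) \<le> card (K - x ` I - {head G e})"
    using p finite_K[OF K(1)] by (intro card_inj_on_le[of p]) auto
  also have "\<dots> < card (K - x ` I)"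
    using y finite_K[OF K(1)] by (intro card_Diff1_less) auto
  finally show ?thesis .
qed

text \<open>For a larger \<open>K\<close> with \<open>t\<close> visits: if \<open>t >= 3\<close>,
  the \<open>2 * t\<close> boundary arcs suffice; if \<open>t <= 2\<close>, five suffice. A sparse
  \<open>K\<close> without vertices of degree 2 has at least \<open>card K + 2 >= 5\<close>; with
  one, it has more than \<open>t\<close> vertices of degree 3. Only the components
  \<open>{x i}\<close> may fall short, by one.\<close>

lemma good_card_edge_cut:
  assumes K: "K \<in> P" "good K"
  shows "3 + card (visits K) \<le> card (edge_cut G K) + of_bool (K \<in> (\<lambda>i. {x i}) ` A)"
proof -
  have KV: "K \<subseteq> verts G" using P_sub[OF K(1)] by blast
  have K0: "K \<noteq> {}" using P_odd[OF K(1)] by auto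
  show ?thesis
  proof (cases "is_singleton K")
    case True
    then obtain v where v: "K = {v}" by (auto simp: is_singleton_def)
    have vis: "visits K = {}" using True by (simp add: visits_def)
    show ?thesis
    proof (cases "sparse G K")
      case sp: True
      show ?thesis
      proof (cases "v \<in> x ` I")
        case True
        then have "K \<in> (\<lambda>i. {x i}) ` A" using K(1) v by (auto simp: A_def)
        then show ?thesis using sparse_card_edge_cut[OF KV K0 sp] vis by simp
      next
        case False
        then have "K - x ` I = {v}" using v by blast
        then have "card (K - x ` I) = 1" by simp
        then show ?thesis using sparse_card_edge_cut[OF KV K0 sp] vis by simp
      qed
    next
      case False
      then show ?thesis using K(2) vis by (simp add: good_def)
    qed
  next
    case False
    then have "card K \<noteq> 1" by (simp add: is_singleton_altdef)
    then have K3: "3 \<le> card K" using P_odd[OF K(1)] by presburger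
    have "3 \<le> card (visits K) \<or> card (visits K) \<le> 2" by linarith
    then consider "3 \<le> card (visits K)" | "card (visits K) \<le> 2" "5 \<le> card (edge_cut G K)"
      | "sparse G K" "K \<inter> x ` I = {}" "card (visits K) \<le> 2" | "sparse G K" "K \<inter> x ` I \<noteq> {}"
      using K(2) unfolding good_def by blast
    then have "3 + card (visits K) \<le> card (edge_cut G K)"
    proof cases
      case 1
      then show ?thesis using card_visits[OF K(1)] by linarith
    next
      case 3
      then have "K - x ` I = K" by blast
      then show ?thesis using sparse_card_edge_cut[OF KV K0] 3 K3 by simp
    next
      case 4
      then obtain j where "j \<in> I" "x j \<in> K" by blast
      then have "card (visits K) < card (K - x ` I)" using card_visits_degree_3[OF K(1)] False by blast
      then show ?thesis using sparse_card_edge_cut[OF KV K0] 4 by simp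
    qed simp
    then show ?thesis by simp
  qed
qed

text \<open>The bound on the boundary uses up the whole degree of \<open>v\<close>, leaving no room
  for a loop.\<close>

lemma good_singleton:
  assumes "{v} \<in> P" "good {v}" "e \<in> arcs G" "tail G e = v"
  shows "head G e \<in> S"
proof -
  have V: "{v} \<subseteq> verts G" using P_sub[OF assms(1)] by blast
  have "card ({v} - x ` I) + 2 \<le> card (edge_cut G {v})"
  proof (cases "sparse G {v}")
    case True
    then show ?thesis using sparse_card_edge_cut[OF V] by simp
  next
    case False
    moreover have "card ({v} - x ` I) \<le> 1" using card_mono[of "{v}" "{v} - x ` I"] by simp
    ultimately show ?thesis using assms(2) by (simp add: good_def)
  qed
  moreover have "3 * card ({v} - x ` I) + 2 * card ({v} \<inter> x ` I) = card ({v} - x ` I) + 2"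
  proof (cases "v \<in> x ` I")
    case False
    then have "{v} - x ` I = {v}" "{v} \<inter> x ` I = {}" by blast+
    then show ?thesis by simp
  qed simp
  ultimately have "card (inner_arcs G {v}) = 0" using card_edge_cut[OF V] by linarith
  then have "inner_arcs G {v} = {}" by (simp add: inner_arcs_def)
  then have "e \<in> edge_cut G {v}" using assms(3,4) by (auto simp: inner_arcs_def edge_cut_def)
  then show ?thesis using edge_cut_head[OF assms(1)] by blast
qed

text \<open>Stated for parts \<open>Q\<close> of \<open>P\<close>, so that a component that is not
  good can be left out.\<close>

lemma sum_good:
  assumes Q: "Q \<subseteq> P" "\<And>K. K \<in> Q \<Longrightarrow> good K"
  shows "3 * card Q + (\<Sum>K\<in>Q. card (visits K)) \<le> (\<Sum>K\<in>Q. card (edge_cut G K)) + card {i \<in> A. {x i} \<in> Q}"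
proof -
  have finQ: "finite Q" using Q(1) finite_P finite_subset by blast
  have "(\<Sum>K\<in>Q. of_bool (K \<in> (\<lambda>i. {x i}) ` A)) = card (Q \<inter> (\<lambda>i. {x i}) ` A)"
    using finQ by (simp add: of_bool_def sum.If_cases Collect_conj_eq[symmetric] Int_def)
  also have "\<dots> \<le> card {i \<in> A. {x i} \<in> Q}"
  proof -
    have "Q \<inter> (\<lambda>i. {x i}) ` A = (\<lambda>i. {x i}) ` {i \<in> A. {x i} \<in> Q}" by blast
    then show ?thesis using finite_A by (simp add: card_image_le)
  qed
  finally have 1: "(\<Sum>K\<in>Q. of_bool (K \<in> (\<lambda>i. {x i}) ` A)) \<le> card {i \<in> A. {x i} \<in> Q}" .
  have "(\<Sum>K\<in>Q. 3 + card (visits K)) \<le> (\<Sum>K\<in>Q. card (edge_cut G K) + of_bool (K \<in> (\<lambda>i. {x i}) ` A))"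
    using Q good_card_edge_cut by (intro sum_mono) blast
  then show ?thesis using 1 by (simp add: sum.distrib)
qed

text \<open>The summed bounds make the arcs inside \<open>S\<close> and the visits together fewer
  than the indices in \<open>A\<close>, yet each odd cycle \<open>C i\<close> with \<open>i\<close>
  in \<open>A\<close> needs one of the two.\<close>

lemma not_all_good: "\<exists>K\<in>P. \<not> good K"
proof (rule ccontr)
  assume "\<not> ?thesis"
  then have good: "good K" if "K \<in> P" for K using that by blast
  have "{i \<in> A. {x i} \<in> P} = A" by (auto simp: A_def)
  then have "3 * card P + (\<Sum>K\<in>P. card (visits K)) \<le> (\<Sum>K\<in>P. card (edge_cut G K)) + card A"
    using sum_good[OF order_refl good] by simp
  then have lower: "6 + card (inner_arcs G S) + (\<Sum>K\<in>P. card (visits K)) \<le> card A"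
    using sum_edge_cut P(3) by linarith
  define B where "B = {i \<in> A. set (C i) \<inter> inner_arcs G S \<noteq> {}}"
  have "A \<subseteq> B \<union> (\<Union>K\<in>P. visits K)"
  proof
    fix i assume iA: "i \<in> A"
    then have iI: "i \<in> I" by (rule A_I)
    obtain u where C: "cas u (C i) u" "set (C i) \<subseteq> arcs G"
      using C_cycle[OF iI] ucycleD by blast
    show "i \<in> B \<union> (\<Union>K\<in>P. visits K)"
    proof (rule ccontr)
      assume no: "i \<notin> B \<union> (\<Union>K\<in>P. visits K)"
      \<comment> \<open>With neither, every vertex of \<open>C i\<close> outside \<open>S\<close> is
        a singleton component whose arcs all lead to \<open>S\<close>, so the cycle
        alternates.\<close>
      have "tail G e \<in> S \<longleftrightarrow> head G e \<notin> S" if e: "e \<in> set (C i)" for e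
      proof
        assume "tail G e \<in> S"
        then show "head G e \<notin> S" using no e C(2) iA by (auto simp: B_def inner_arcs_def)
      next
        assume hS: "head G e \<notin> S"
        show "tail G e \<in> S"
        proof (rule ccontr)
          assume "tail G e \<notin> S"
          moreover have "tail G e \<in> verts G" using e C(2) by (intro tail_in_verts) blast
          ultimately have "tail G e \<in> \<Union>P" by (simp add: P(1))
          then obtain K where K: "K \<in> P" "tail G e \<in> K" by blast
          have "tail G e \<in> cycle_verts G (C i)" using e by (simp add: cycle_verts_def)
          then have "is_singleton K" using no iA K by (auto simp: visits_def)
          then have "K = {tail G e}" using K(2) by (auto simp: is_singleton_def)
          then show False using good_singleton[of "tail G e" e] good K e C(2) hS by auto
        qed
      qed
      then have "even (length (C i))" using cas_alternating[OF C(1)] by blast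
      then show False using C_odd[OF iI] by simp
    qed
  qed
  then have "card A \<le> card (B \<union> (\<Union>K\<in>P. visits K))"
    using finite_A finite_P finite_visits by (intro card_mono) (auto simp: B_def)
  also have "\<dots> \<le> card B + card (\<Union>K\<in>P. visits K)" by (rule card_Un_le)
  also have "card (\<Union>K\<in>P. visits K) \<le> (\<Sum>K\<in>P. card (visits K))" using finite_P by (rule card_UN_le)
  also have "card B \<le> card (inner_arcs G S)"
  proof -
    have "\<forall>i\<in>B. \<exists>e. e \<in> set (C i) \<and> e \<in> inner_arcs G S" by (auto simp: B_def)
    then obtain c where c: "\<And>i. i \<in> B \<Longrightarrow> c i \<in> set (C i) \<and> c i \<in> inner_arcs G S" by metis
    have "inj_on c B"
    proof (rule inj_onI)
      fix i j assume ij: "i \<in> B" "j \<in> B" "c i = c j"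
      then have "tail G (c i) \<in> cycle_verts G (C i)" "tail G (c i) \<in> cycle_verts G (C j)"
        using c[OF ij(1)] c[OF ij(2)] by (auto simp: cycle_verts_def)
      then show "i = j" using C_unique ij A_I by (auto simp: B_def)
    qed
    then show ?thesis using c by (intro card_inj_on_le[of c]) (auto simp: inner_arcs_def)
  qed
  finally show False using lower by linarith
qed

text \<open>Otherwise the complement of \<open>K\<close> is a forest with at most two vertices of degree 3, but these
  are joined by at least three subdivided edges.\<close>

lemma all_good: "K \<in> P \<Longrightarrow> good K"
proof (rule ccontr)
  assume K: "K \<in> P" and bad: "\<not> good K"
  let ?Z = "verts G - K"
  have KV: "K \<subseteq> verts G" and SZ: "S \<subseteq> ?Z" using P_sub[OF K] S by blast+
  have sp: "sparse G ?Z"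
    using cut_sparse bad KV unfolding cut_sparse_def good_def by (meson not_le)
  let ?Q = "P - {K}"
  have QZ: "L \<subseteq> ?Z" if "L \<in> ?Q" for L using that P_sub[of L] P_eq[of L K] K by blast
  have goodQ: "good L" if "L \<in> ?Q" for L
    using sp QZ[OF that] unfolding good_def sparse_def by blast
  define B where "B = {i \<in> A. {x i} \<in> ?Q}"
  have finB: "finite B" using finite_A by (simp add: B_def)
  have cardQ: "card P = Suc (card ?Q)" using card.remove[OF finite_P K] .
  have "(\<Sum>L\<in>?Q. card (edge_cut G L)) \<le> (\<Sum>L\<in>P. card (edge_cut G L))"
    using finite_P by (intro sum_mono2) auto
  \<comment> \<open>At least \<open>card S + 1\<close> good components remain, but their boundaries
    have at most \<open>3 * card S\<close> arcs in total, so at least three of them are of the form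
    \<open>{x i}\<close>.\<close>
  then have B3: "3 \<le> card B"
    using sum_good[of ?Q] goodQ sum_edge_cut P(3) cardQ unfolding B_def by auto
  have Z0: "?Z \<noteq> {}"
  proof -
    have "card ?Q \<noteq> 0" using cardQ P(3) by linarith
    then have "?Q \<noteq> {}" by (metis card.empty)
    then obtain L where "L \<in> ?Q" by blast
    then have "L \<subseteq> ?Z" "L \<noteq> {}" using QZ P_odd by force+
    then show ?thesis by blast
  qed
  have "card (edge_cut G ?Z) \<le> card (edge_cut G K)"
  proof (rule card_inj_on_le)
    show "arev ` edge_cut G ?Z \<subseteq> edge_cut G K" by (auto simp: edge_cut_def)
  qed (auto simp: edge_cut_def)
  \<comment> \<open>As \<open>K\<close> is not good, the boundary has at most four arcs, and a
    sparse set has at least two more of them than vertices of degree 3.\<close>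
  then have Z2: "card (?Z - x ` I) \<le> 2"
    using sparse_card_edge_cut[OF _ Z0 sp] bad unfolding good_def by auto
  \<comment> \<open>With \<open>b = card B\<close>, the two arcs at each \<open>x i\<close> and
    their reverses put \<open>4 * b\<close> arcs inside \<open>?Y\<close>, while sparseness allows
    fewer than \<open>2 * (b + 2)\<close>. This contradicts \<open>b >= 3\<close>.\<close>
  let ?Y = "x ` B \<union> (?Z - x ` I)"
  have BI: "B \<subseteq> I" using A_I by (auto simp: B_def)
  have "x i \<in> ?Z" if "i \<in> B" for i using that QZ[of "{x i}"] by (auto simp: B_def)
  then have YZ: "?Y \<subseteq> ?Z" by blast
  have cardB: "card (x ` B) = card B" using x_inj BI by (intro card_image) (rule inj_on_subset)
  define D where "D = (\<Union>v\<in>x ` B. out_arcs G v)"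
  have D: "e \<in> arcs G \<and> tail G e \<in> x ` B \<and> head G e \<in> ?Z - x ` I" if e: "e \<in> D" for e
  proof -
    obtain i where i: "i \<in> B" "e \<in> arcs G" "tail G e = x i" using e by (auto simp: D_def)
    have xi: "{x i} \<in> ?Q" using i(1) by (simp add: B_def)
    then have "head G e \<in> S" using good_singleton[of "x i" e] goodQ i by blast
    moreover have "x i \<notin> S" using P_sub[of "{x i}"] xi by blast
    ultimately have "head G e \<in> ?Z" "head G e \<noteq> x i" using SZ by auto
    moreover have "head G e \<notin> x ` I"
      using x_neighbour_not_x[OF _ i(2,3)] \<open>head G e \<noteq> x i\<close> i(1) BI by blast
    ultimately show ?thesis using i by simp
  qed
  have "card D = (\<Sum>v\<in>x ` B. out_degree G v)"
    unfolding D_def out_degree_def using finB by (intro card_UN_disjoint) auto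
  also have "\<dots> = (\<Sum>v\<in>x ` B. 2)" using x_image BI by (intro sum.cong) auto
  finally have cardD: "card D = 2 * card B" using cardB by simp
  have finD: "finite D" using finB by (auto simp: D_def)
  have "arev e \<notin> D" if "e \<in> D" for e
  proof
    assume "arev e \<in> D"
    then have "head G e \<in> x ` B" using D[of "arev e"] D[OF that] by simp
    then show False using D[OF that] BI by blast
  qed
  then have "D \<inter> arev ` D = {}" by blast
  then have "card (D \<union> arev ` D) = card D + card (arev ` D)" using finD by (intro card_Un_disjoint) auto
  also have "card (arev ` D) = card D" by (intro card_image inj_on_arev)
  finally have "4 * card B = card (D \<union> arev ` D)" using cardD by simp
  also have "\<dots> \<le> card (inner_arcs G ?Y)"
  proof (rule card_mono)
    have "e \<in> inner_arcs G ?Y \<and> arev e \<in> inner_arcs G ?Y" if "e \<in> D" for e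
      using D[OF that] by (simp add: inner_arcs_def)
    then show "D \<union> arev ` D \<subseteq> inner_arcs G ?Y" by blast
  qed (simp add: inner_arcs_def)
  also have "\<dots> < 2 * card ?Y"
    using sp YZ B3 unfolding sparse_def by (metis Un_empty card.empty cardB not_numeral_le_zero)
  finally have "4 * card B < 2 * card ?Y" .
  moreover have "card ?Y \<le> card B + card (?Z - x ` I)" using card_Un_le cardB by metis
  ultimately show False using B3 Z2 by linarith
qed

lemma contradiction: False
  using not_all_good all_good by blast

end

section \<open>Applying Tutte's theorem to the multigraph\<close>

lemma (in odd_cycle_cover) perfect_matching_ex: "\<exists>M. perfect_matching G arev M"
proof (rule ccontr)
  assume no: "\<not> ?thesis"
  have ends: "\<forall>m\<in>edge_ends G. m \<subseteq> verts G \<and> card m = 2" by (auto simp: edge_ends_def)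
  have nopm: "\<nexists>M. matching (edge_ends G) M \<and> \<Union>M = verts G"
    using no perfect_matching_if_matching by blast
  obtain S P where SP: "S \<subseteq> verts G" "\<Union>P = verts G - S" "disjoint P" "card S + 2 \<le> card P"
    "\<And>K. K \<in> P \<Longrightarrow> odd (card K)"
    and sep: "\<And>m. m \<in> edge_ends G \<Longrightarrow> m \<inter> S = {} \<Longrightarrow> \<exists>K\<in>P. m \<subseteq> K"
    and conn: "\<And>K v. K \<in> P \<Longrightarrow> v \<in> K \<Longrightarrow> K \<noteq> {v} \<Longrightarrow> \<exists>y\<in>K. {v, y} \<in> edge_ends G"
    using tutte_gallai[OF finite_verts ends even_card_verts nopm] by metis
  interpret tutte_violation G arev I x C S P
  proof
    show "\<exists>K\<in>P. tail G e \<in> K \<and> head G e \<in> K"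
      if "e \<in> arcs G" "tail G e \<notin> S" "head G e \<notin> S" for e
    \<comment> \<open>A loop leaves no trace in \<open>edge_ends\<close>, but its vertex still lies
      in some member of \<open>P\<close>.\<close>
    proof (cases "tail G e = head G e")
      case True
      then show ?thesis using that SP(2) head_in_verts[of e] by auto
    next
      case False
      then have "{tail G e, head G e} \<in> edge_ends G" using that by (auto simp: edge_ends_def)
      then show ?thesis using sep[of "{tail G e, head G e}"] that by auto
    qed
    show "\<exists>e\<in>arcs G. tail G e = v \<and> head G e \<in> K - {v}" if K: "K \<in> P" "v \<in> K" "K \<noteq> {v}" for K v
    proof -
      obtain y where y: "y \<in> K" "{v, y} \<in> edge_ends G" using conn[OF K] by blast
      then obtain e where e: "e \<in> arcs G" "tail G e \<noteq> head G e" "{v, y} = {tail G e, head G e}"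
        by (auto simp: edge_ends_def)
      then have "tail G e = v \<and> head G e = y \<and> y \<noteq> v \<or> tail G (arev e) = v \<and> head G (arev e) = y \<and> y \<noteq> v"
        by (auto simp: doubleton_eq_iff)
      then show ?thesis using y(1) e(1) arev_in_arcs by blast
    qed
  qed (use SP in auto)
  show False by (rule contradiction)
qed

theorem theorem6:
  fixes H G :: "('a, 'b) pre_digraph"
    and rev_H rev_G :: "'b \<Rightarrow> 'b"
    and k :: nat
    and x :: "nat \<Rightarrow> 'a"
    and C :: "nat \<Rightarrow> 'b list"
  assumes "fin_digraph H"
    and "bidirected_digraph H rev_H"
    and "cubic H"
    and "cyclically_edge_connected 5 H rev_H"
    and "subdivision (H, rev_H) (G, rev_G)"
    and "bij_betw x {1..2 * k} {v \<in> verts G. out_degree G v = 2}"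
    and "\<And>i. i \<in> {1..2 * k} \<Longrightarrow> ucycle G rev_G (C i)"
    and "\<And>i. i \<in> {1..2 * k} \<Longrightarrow> odd (length (C i))"
    and "\<And>i. i \<in> {1..2 * k} \<Longrightarrow> x i \<in> cycle_verts G (C i)"
    and "\<And>i j. i \<in> {1..2 * k} \<Longrightarrow> j \<in> {1..2 * k} \<Longrightarrow> i \<noteq> j \<Longrightarrow>
           cycle_verts G (C i) \<inter> cycle_verts G (C j) = {}"
  shows "\<exists>M. perfect_matching G rev_G M"
proof -
  have G: "fin_digraph G" "\<forall>v\<in>verts G. out_degree G v \<in> {2, 3}" "cut_sparse G"
    using subdivision_cubic[OF assms(5,1,3)]
      cyclically_edge_connected_imp_cut_sparse[OF assms(1,2,4)] by auto
  interpret fin_digraph G by fact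
  interpret bidirected_digraph G rev_G using assms(5) by (rule subdivision_bidir)
  interpret odd_cycle_cover G rev_G "{1..2 * k}" x C
    by unfold_locales (use G assms in auto)
  show ?thesis by (rule perfect_matching_ex)
qed

end
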